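(* Let $\mathbf{f}^{(k)},\mathbf{t}^{(k)}\in\mathbb{R}^3$, $k=1,\dots,P$, be given (desired net forces and torques), and for each $k$ let $$\boldsymbol{\lambda}_0^{(k)}=\mathbf{K}_N^{(k)}\begin{bmatrix}\boldsymbol{\nu}^{(k)}\\ \boldsymbol{\xi}^{(k)}\end{bmatrix}\in\mathbb{R}^{3N},\qquad\text{where } \boldsymbol{\nu}^{(k)},\boldsymbol{\xi}^{(k)}\in\mathbb{R}^3 \text{ solve}\quad {\mathbf{K}_N^{(k)}}^T\mathbf{K}_N^{(k)}\begin{bmatrix}\boldsymbol{\nu}^{(k)}\\ \boldsymbol{\xi}^{(k)}\end{bmatrix}=\begin{bmatrix}\mathbf{f}^{(k)}\\ \mathbf{t}^{(k)}\end{bmatrix}.$$ Let $\boldsymbol{\lambda}=\{\boldsymbol{\lambda}^{(k)}\}_{k=1}^P$, with blocks $\boldsymbol{\lambda}^{(k)}\in\mathbb{R}^{3N}$, solve the tall linear system with block rows $$\left[\mathbf{S}^{(kk)}(\mathbf{I}-\mathbf{L}^{(k)})+\mathbf{L}_r^{(k)}\right]\boldsymbol{\lambda}^{(k)}+\sum_{k'\neq k}\mathbf{S}^{(kk')}(\mathbf{I}-\mathbf{L}^{(k')})\boldsymbol{\lambda}^{(k')}=-\mathbf{u}_0^{(k)},\qquad k=1,\dots,P,$$ where the right-hand side has block components $$\mathbf{u}_0^{(k)}=\sum_{k'=1}^P\mathbf{S}^{(kk')}\boldsymbol{\lambda}_0^{(k')},\qquad k=1,\dots,P.$$ Let $\mathbf{u}$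 be the flow field $$\mathbf{u}(\mathbf{x})=\sum_{k=1}^P\sum_{j=1}^N\mathbf{G}(\mathbf{x},\mathbf{y}_j^{(k)})\boldsymbol{\beta}_j^{(k)},\qquad \boldsymbol{\beta}^{(k)}:=(\mathbf{I}-\mathbf{L}^{(k)})\boldsymbol{\lambda}^{(k)}+\boldsymbol{\lambda}_0^{(k)},$$ with $\boldsymbol{\beta}^{(k)}$ the stack of $\boldsymbol{\beta}_j^{(k)}\in\mathbb{R}^3$, $j=1,\dots,N$. Then: 1. $\mathbf{u}$ satisfies the Stokes equations in $\mathbb{R}^3\setminus\overline{\Omega}$, i.e. there is a pressure $p$ with $-\mu\Delta\mathbf{u}+\nabla p=\mathbf{0}$ and $\nabla\cdot\mathbf{u}=0$ there; 2. $\mathbf{u}$ obeys rigid body motion on each particle surface, i.e. for each $k$ there are $\mathbf{v}^{(k)},\boldsymbol{\omega}^{(k)}\in\mathbb{R}^3$ with $\mathbf{u}(\mathbf{x})=\mathbf{v}^{(k)}+\boldsymbol{\omega}^{(k)}\times(\mathbf{x}-\mathbf{c}^{(k)})$ on $\partial\Omega^{(k)}$; 3. $\mathbf{u}$ corresponds to the desired net forces and torques on the particles, i.e. for each $k$, $\sum_{j=1}^N\boldsymbol{\beta}_j^{(k)}=\mathbf{f}^{(k)}$ and $\sum_{j=1}^N(\mathbf{y}_j^{(k)}-\mathbf{c}^{(k)})\times\boldsymbol{\beta}_j^{(k)}=\mathbf{t}^{(k)}$; 4. the stack $\mathbf{U}\in\mathbb{R}^{6P}$ of all rigid body motions, with blocks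 $\mathbf{U}^{(k)}=[{\mathbf{v}^{(k)}}^T,{\boldsymbol{\omega}^{(k)}}^T]^T$, may be extracted via $\mathbf{U}=-\mathbf{K}_N^T\boldsymbol{\lambda}$, that is, $\mathbf{U}^{(k)}=-{\mathbf{K}_N^{(k)}}^T\boldsymbol{\lambda}^{(k)}$ for $k=1,\dots,P$.
   Context: $\Omega^{(k)}$, $k=1,\dots,P$, are smooth bounded disjoint objects (rigid particles) in $\mathbb{R}^3$ with boundaries (particle surfaces) $\partial\Omega^{(k)}$ and centers $\mathbf{c}^{(k)}\in\mathbb{R}^3$, and $\Omega=\bigcup_{k=1}^P\Omega^{(k)}$. The fluid viscosity is a constant $\mu>0$. For each $k$, $\mathbf{y}_j^{(k)}$, $j=1,\dots,N$, are proxy (source) points inside $\Omega^{(k)}$, and $\mathbf{x}_i^{(k)}$, $i=1,\dots,M$, are collocation points (nodes) on $\partial\Omega^{(k)}$; $N$ and $M$ do not depend on $k$. The Stokeslet is the $3\times3$ matrix $$\mathbf{G}(\mathbf{x},\mathbf{y})=\frac{1}{8\pi\mu\|\mathbf{x}-\mathbf{y}\|}\left(\mathbf{I}_3+\frac{(\mathbf{x}-\mathbf{y})(\mathbf{x}-\mathbf{y})^T}{\|\mathbf{x}-\mathbf{y}\|^2}\right),$$ with $\mathbf{I}_3$ the $3\times3$ identity. The matrix $\mathbf{S}^{(kk')}\in\mathbb{R}^{3M\times3N}$ has $3\times3$ blocks $\mathbf{G}(\mathbf{x}_i^{(k)},\mathbf{y}_j^{(k')})$, $i=1,\dots,M$,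 $j=1,\dots,N$. For $\mathbf{d}\in\mathbb{R}^3$ let $$(\mathbf{d})_\times=\begin{bmatrix}0&d_3&-d_2\\-d_3&0&d_1\\d_2&-d_1&0\end{bmatrix},$$ so that $(\mathbf{d})_\times\boldsymbol{\omega}=\boldsymbol{\omega}\times\mathbf{d}$. The matrix $\mathbf{K}_M^{(k)}\in\mathbb{R}^{3M\times6}$ has block rows $[\mathbf{I}_3\;\;(\mathbf{x}_i^{(k)}-\mathbf{c}^{(k)})_\times]$, $i=1,\dots,M$, and $\mathbf{K}_N^{(k)}\in\mathbb{R}^{3N\times6}$ has block rows $[\mathbf{I}_3\;\;(\mathbf{y}_j^{(k)}-\mathbf{c}^{(k)})_\times]$, $j=1,\dots,N$. $\mathbf{K}_N$ is the block diagonal matrix with diagonal blocks $\mathbf{K}_N^{(1)},\dots,\mathbf{K}_N^{(P)}$. It is assumed that each $6\times 6$ matrix ${\mathbf{K}_N^{(k)}}^T\mathbf{K}_N^{(k)}$ is invertible. $\mathbf{I}$ is the $3N\times3N$ identity, and for each $k$ $$\mathbf{L}^{(k)}=\mathbf{K}_N^{(k)}\left({\mathbf{K}_N^{(k)}}^T\mathbf{K}_N^{(k)}\right)^{-1}{\mathbf{K}_N^{(k)}}^T\in\mathbb{R}^{3N\times3N},\qquad \mathbf{L}_r^{(k)}=\mathbf{K}_M^{(k)}{\mathbf{K}_N^{(k)}}^T\in\mathbb{R}^{3M\times3N}.$$ The net force and torque on particle $k$ for a flow $\sum_k\sum_j\mathbf{G}(\cdot,\mathbf{y}_j^{(k)})\boldsymbol{\beta}_j^{(k)}$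 are $\sum_{j}\boldsymbol{\beta}_j^{(k)}$ and $\sum_{j}(\mathbf{y}_j^{(k)}-\mathbf{c}^{(k)})\times\boldsymbol{\beta}_j^{(k)}$, respectively.
   Formalization: Item 2 is false as stated: rigid body motion is proved at the collocation nodes, and on all of each particle surface only if the nodes resolve it (every proxy flow equal to a rigid motion at that particle's nodes equals it on the whole surface). *)

theory Defs
  imports "HOL-Analysis.Analysis"
begin

subsection \<open>Differential operators on fields on $R^n$\<close>

definition partial_deriv :: "'d::finite \<Rightarrow> (real^'d \<Rightarrow> 'b::real_normed_vector) \<Rightarrow> real^'d \<Rightarrow> 'b"
  where "partial_deriv i f z = frechet_derivative f (at z) (axis i 1)"

definition gradient :: "(real^'d::finite \<Rightarrow> real) \<Rightarrow> real^'d \<Rightarrow> real^'d"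
  where "gradient p z = (\<chi> i. partial_deriv i p z)"

definition divergence :: "(real^'d::finite \<Rightarrow> real^'d) \<Rightarrow> real^'d \<Rightarrow> real"
  where "divergence u z = (\<Sum>i\<in>UNIV. partial_deriv i u z $ i)"

definition laplacian :: "(real^'d::finite \<Rightarrow> 'b::real_normed_vector) \<Rightarrow> real^'d \<Rightarrow> 'b"
  where "laplacian u z = (\<Sum>i\<in>UNIV. partial_deriv i (partial_deriv i u) z)"

text \<open>Classical solutions. The differentiability conditions guarantee that every derivative in the
  equations exists, since \<^const>\<open>frechet_derivative\<close> is an arbitrary value where there is none.\<close>

definition stokes_solution ::
    "real \<Rightarrow> (real^3 \<Rightarrow> real^3) \<Rightarrow> (real^3 \<Rightarrow> real) \<Rightarrow> (real^3) set \<Rightarrow> bool"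
  where "stokes_solution \<mu> u p D \<longleftrightarrow>
    (\<forall>z\<in>D. u differentiable (at z)
         \<and> (\<forall>i. partial_deriv i u differentiable (at z))
         \<and> p differentiable (at z)
         \<and> - \<mu> *\<^sub>R laplacian u z + gradient p z = 0
         \<and> divergence u z = 0)"

text \<open>On an open set this is \<open>C\<^sup>\<infinity>\<close>: all iterated partial derivatives are differentiable.\<close>

definition smooth_on :: "(real^'d::finite) set \<Rightarrow> (real^'d \<Rightarrow> real) \<Rightarrow> bool"
  where "smooth_on V \<phi> \<longleftrightarrow> (\<forall>is. foldr partial_deriv is \<phi> differentiable_on V)"

text \<open>Near each boundary point the domain is the sublevel set of a smooth function with
  nonvanishing gradient, i.e. it lies on one side of a smooth surface.\<close>

definition smooth_bounded_domain :: "(real^3) set \<Rightarrow> bool"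
  where "smooth_bounded_domain D \<longleftrightarrow> open D \<and> bounded D \<and>
    (\<forall>z\<in>frontier D. \<exists>V \<phi>. open V \<and> z \<in> V \<and> smooth_on V \<phi> \<and> gradient \<phi> z \<noteq> 0
        \<and> D \<inter> V = {w\<in>V. \<phi> w < 0})"


subsection \<open>Stacked vectors and block matrices\<close>

text \<open>Vectors in $R^{3N}$ are indexed by pairs (point, coordinate), vectors in $R^6$ by the
  disjoint sum \<open>3 + 3\<close>.\<close>

definition block :: "real^('n::finite \<times> 3) \<Rightarrow> 'n \<Rightarrow> real^3"
  where "block b j = (\<chi> a. b $ (j, a))"

definition stack2 :: "real^3 \<Rightarrow> real^3 \<Rightarrow> real^(3 + 3)"
  where "stack2 v w = (\<chi> q. case q of Inl a \<Rightarrow> v $ a | Inr a \<Rightarrow> w $ a)"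

definition stack :: "('p::finite \<Rightarrow> real^'r::finite) \<Rightarrow> real^('p \<times> 'r)"
  where "stack b = (\<chi> kr. b (fst kr) $ snd kr)"

definition block_diag :: "('p::finite \<Rightarrow> real^'s::finite^'r::finite) \<Rightarrow> real^('p \<times> 's)^('p \<times> 'r)"
  where "block_diag A =
    (\<chi> kr ks. if fst kr = fst ks then A (fst kr) $ snd kr $ snd ks else 0)"

definition stokeslet :: "real \<Rightarrow> real^3 \<Rightarrow> real^3 \<Rightarrow> real^3^3"
  where "stokeslet \<mu> x y = (1 / (8 * pi * \<mu> * norm (x - y))) *\<^sub>R
    (mat 1 + (1 / (norm (x - y))\<^sup>2) *\<^sub>R (\<chi> a b. (x - y) $ a * (x - y) $ b))"

text \<open>Blocks of the Stokeslet matrix: target points \<open>x i\<close> (rows), source points \<open>y j\<close> (columns).\<close>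

definition S_mat :: "real \<Rightarrow> ('m::finite \<Rightarrow> real^3) \<Rightarrow> ('n::finite \<Rightarrow> real^3) \<Rightarrow> real^('n \<times> 3)^('m \<times> 3)"
  where "S_mat \<mu> x y = (\<chi> ia jb. stokeslet \<mu> (x (fst ia)) (y (fst jb)) $ snd ia $ snd jb)"

text \<open>The matrix of \<open>w \<mapsto> w \<times> d\<close>.\<close>

definition cross_mat :: "real^3 \<Rightarrow> real^3^3"
  where "cross_mat d = vector [vector [0, d$3, - d$2],
                               vector [- d$3, 0, d$1],
                               vector [d$2, - d$1, 0]]"

definition K_mat :: "real^3 \<Rightarrow> ('n::finite \<Rightarrow> real^3) \<Rightarrow> real^(3 + 3)^('n \<times> 3)"
  where "K_mat c z = (\<chi> ja q. case q of
      Inl b \<Rightarrow> (mat 1 :: real^3^3) $ snd ja $ b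
    | Inr b \<Rightarrow> cross_mat (z (fst ja) - c) $ snd ja $ b)"

definition L_mat :: "real^3 \<Rightarrow> ('n::finite \<Rightarrow> real^3) \<Rightarrow> real^('n \<times> 3)^('n \<times> 3)"
  where "L_mat c y =
    K_mat c y ** matrix_inv (transpose (K_mat c y) ** K_mat c y) ** transpose (K_mat c y)"

definition Lr_mat :: "real^3 \<Rightarrow> ('m::finite \<Rightarrow> real^3) \<Rightarrow> ('n::finite \<Rightarrow> real^3) \<Rightarrow> real^('n \<times> 3)^('m \<times> 3)"
  where "Lr_mat c x y = K_mat c x ** transpose (K_mat c y)"


subsection \<open>Flows\<close>

definition flow :: "real \<Rightarrow> ('p::finite \<Rightarrow> 'n::finite \<Rightarrow> real^3) \<Rightarrow> ('p \<Rightarrow> real^('n \<times> 3)) \<Rightarrow> real^3 \<Rightarrow> real^3"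
  where "flow \<mu> y \<beta> z = (\<Sum>k\<in>UNIV. \<Sum>j\<in>UNIV. stokeslet \<mu> z (y k j) *v block (\<beta> k) j)"

definition rigid_motion :: "real^3 \<Rightarrow> real^3 \<Rightarrow> real^3 \<Rightarrow> real^3 \<Rightarrow> real^3"
  where "rigid_motion c v w z = v + cross3 w (z - c)"

text \<open>The nodes \<open>x i\<close> resolve the surface \<open>\<Gamma>\<close> of a particle with center \<open>c\<close>: a flow generated by
  the proxy points \<open>y\<close> that is a given rigid body motion at all nodes is that motion on all of \<open>\<Gamma>\<close>.
  Collocation alone does not imply this: the flow of a single point force at the center of a ball
  is a constant on the equator orthogonal to the force, but not a rigid body motion on the sphere.
  The condition involves neither the forces and torques nor the solution of the linear system.\<close>

definition nodes_resolve_surface ::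
    "real \<Rightarrow> ('p::finite \<Rightarrow> 'n::finite \<Rightarrow> real^3) \<Rightarrow> real^3 \<Rightarrow> ('m::finite \<Rightarrow> real^3) \<Rightarrow> (real^3) set \<Rightarrow> bool"
  where "nodes_resolve_surface \<mu> y c x \<Gamma> \<longleftrightarrow>
    (\<forall>\<alpha> v w. (\<forall>i. flow \<mu> y \<alpha> (x i) = rigid_motion c v w (x i)) \<longrightarrow>
             (\<forall>z\<in>\<Gamma>. flow \<mu> y \<alpha> z = rigid_motion c v w z))"

end

theory Submission
  imports Defs
begin

text \<open>Away from the proxy points, each Stokeslet flow solves the Stokes equations with pressure
  \<open>r \<bullet> b / (4 \<pi> \<bar>r\<bar>\<^sup>3)\<close>, \<open>r = z - y\<close>, and solutions superpose. The transpose of \<open>K\<^sub>N\<close> takes net force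
  and torque, and it annihilates the range of \<open>I - L\<close> because \<open>L\<close> is the orthogonal projection onto
  the range of \<open>K\<^sub>N\<close>; so force and torque come from \<open>\<lambda>\<^sub>0\<close> alone. Subtracting the recompletion term
  from the linear system leaves \<open>S \<beta> = - K\<^sub>M K\<^sub>N\<^sup>T \<lambda>\<close> at the nodes, which is a rigid body motion with
  coefficients \<open>- K\<^sub>N\<^sup>T \<lambda>\<close>.\<close>

section \<open>Partial derivatives and superposition of Stokes solutions\<close>

lemma partial_deriv_eqI:
  assumes "(f has_derivative f') (at z)"
  shows "partial_deriv i f z = f' (axis i 1)"
  using frechet_derivative_at[OF assms] by (simp add: partial_deriv_def)

text \<open>Derivatives are local, so agreement on an open set transfers them. This is needed for
  second partials: the first partial is known in closed form only on the open domain, yet it must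
  itself be differentiated.\<close>

lemma partial_deriv_cong_open:
  assumes "open D" "z \<in> D" "\<And>w. w \<in> D \<Longrightarrow> f w = g w" "g differentiable (at z)"
  shows "f differentiable (at z)" "partial_deriv i f z = partial_deriv i g z"
proof -
  have "(g has_derivative frechet_derivative g (at z)) (at z)"
    using assms(4) by (simp add: frechet_derivative_works)
  then have "(f has_derivative frechet_derivative g (at z)) (at z)"
    by (rule has_derivative_transform_within_open[OF _ assms(1,2)]) (simp add: assms(3))
  then show "f differentiable (at z)" "partial_deriv i f z = partial_deriv i g z"
    by (auto simp: differentiable_def partial_deriv_eqI) (simp add: partial_deriv_def)
qed

lemma partial_deriv_sum:
  assumes "\<And>s. s \<in> A \<Longrightarrow> f s differentiable (at z)"
  shows "partial_deriv i (\<lambda>z. \<Sum>s\<in>A. f s z) z = (\<Sum>s\<in>A. partial_deriv i (f s) z)"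
proof -
  have "((\<lambda>z. \<Sum>s\<in>A. f s z) has_derivative (\<lambda>h. \<Sum>s\<in>A. frechet_derivative (f s) (at z) h)) (at z)"
    using assms by (intro has_derivative_sum) (simp add: frechet_derivative_works)
  then show ?thesis
    by (simp add: partial_deriv_eqI) (simp add: partial_deriv_def)
qed

lemma differentiable_finite_sum:
  assumes "\<And>s. s \<in> A \<Longrightarrow> f s differentiable (at z)"
  shows "(\<lambda>z. \<Sum>s\<in>A. f s z) differentiable (at z)"
  using assms by (induction A rule: infinite_finite_induct) auto

text \<open>Linearity of the equations. Openness of \<open>D\<close> matters for the Laplacian: the
  sum rule for first partials must hold in a neighbourhood of \<open>z\<close> before it can be
  differentiated again.\<close>

lemma stokes_solution_sum:
  assumes D: "open D" and sol: "\<And>s. s \<in> A \<Longrightarrow> stokes_solution \<mu> (u s) (p s) D"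
  shows "stokes_solution \<mu> (\<lambda>z. \<Sum>s\<in>A. u s z) (\<lambda>z. \<Sum>s\<in>A. p s z) D"
  unfolding stokes_solution_def
proof (intro ballI conjI allI)
  fix z assume z: "z \<in> D"
  have du: "u s differentiable (at w)" and ddu: "partial_deriv i (u s) differentiable (at w)"
    and dp: "p s differentiable (at w)"
    and mom: "- \<mu> *\<^sub>R laplacian (u s) w + gradient (p s) w = 0"
    and div: "divergence (u s) w = 0" if "s \<in> A" "w \<in> D" for s w i
    using sol[OF that(1)] that(2) unfolding stokes_solution_def by auto
  have pu: "partial_deriv i (\<lambda>z. \<Sum>s\<in>A. u s z) w = (\<Sum>s\<in>A. partial_deriv i (u s) w)"
    if "w \<in> D" for i w
    using du that by (simp add: partial_deriv_sum)
  have dpu: "(\<lambda>w. \<Sum>s\<in>A. partial_deriv i (u s) w) differentiable (at z)" for i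
    using ddu z by (simp add: differentiable_finite_sum)
  show "(\<lambda>z. \<Sum>s\<in>A. u s z) differentiable (at z)"
    using du z by (simp add: differentiable_finite_sum)
  show "partial_deriv i (\<lambda>z. \<Sum>s\<in>A. u s z) differentiable (at z)" for i
    using partial_deriv_cong_open(1)[OF D z pu dpu] .
  show "(\<lambda>z. \<Sum>s\<in>A. p s z) differentiable (at z)"
    using dp z by (simp add: differentiable_finite_sum)
  have "laplacian (\<lambda>z. \<Sum>s\<in>A. u s z) z = (\<Sum>i\<in>UNIV. \<Sum>s\<in>A. partial_deriv i (partial_deriv i (u s)) z)"
    unfolding laplacian_def
    using partial_deriv_cong_open(2)[OF D z pu dpu] ddu z by (simp add: partial_deriv_sum)
  also have "\<dots> = (\<Sum>s\<in>A. laplacian (u s) z)"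
    unfolding laplacian_def by (rule sum.swap)
  finally have lap: "laplacian (\<lambda>z. \<Sum>s\<in>A. u s z) z = (\<Sum>s\<in>A. laplacian (u s) z)" .
  have grad: "gradient (\<lambda>z. \<Sum>s\<in>A. p s z) z = (\<Sum>s\<in>A. gradient (p s) z)"
    using dp z by (simp add: gradient_def partial_deriv_sum vec_eq_iff)
  have "(\<Sum>s\<in>A. - \<mu> *\<^sub>R laplacian (u s) z + gradient (p s) z) = 0"
    using mom z by (intro sum.neutral) auto
  then show "- \<mu> *\<^sub>R laplacian (\<lambda>z. \<Sum>s\<in>A. u s z) z + gradient (\<lambda>z. \<Sum>s\<in>A. p s z) z = 0"
    by (simp add: lap grad sum.distrib scaleR_sum_right sum_negf sum_subtractf)
  have "divergence (\<lambda>z. \<Sum>s\<in>A. u s z) z = (\<Sum>s\<in>A. divergence (u s) z)"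
    unfolding divergence_def using pu z by (simp add: sum.swap[of _ UNIV A])
  also have "\<dots> = 0"
    using div z by (intro sum.neutral) auto
  finally show "divergence (\<lambda>z. \<Sum>s\<in>A. u s z) z = 0" .
qed

lemma stokes_solution_subset:
  "stokes_solution \<mu> u p D \<Longrightarrow> E \<subseteq> D \<Longrightarrow> stokes_solution \<mu> u p E"
  unfolding stokes_solution_def by blast


section \<open>The Stokeslet\<close>

text \<open>Only powers of the inverse distance and polynomials in \<open>z - y\<close> remain,
  ready for the product rule. At \<open>z = y\<close> both sides are 0, since division by zero gives
  0.\<close>

lemma stokeslet_mult_vec:
  "stokeslet \<mu> z y *v b = (1 / (8 * pi * \<mu>)) *\<^sub>R
     (inverse (norm (z - y)) *\<^sub>R b + (inverse (norm (z - y)) ^ 3 * ((z - y) \<bullet> b)) *\<^sub>R (z - y))"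
proof -
  have "(\<chi> a c. (z - y) $ a * (z - y) $ c) *v b = ((z - y) \<bullet> b) *\<^sub>R (z - y)"
    by (simp add: vec_eq_iff matrix_vector_mult_def inner_vec_def sum_distrib_left
        sum_distrib_right mult_ac)
  then show ?thesis
    by (simp add: stokeslet_def scaleR_matrix_vector_assoc[symmetric] matrix_vector_mult_add_rdistrib
        scaleR_add_right divide_simps power3_eq_cube power2_eq_square)
qed

lemma has_derivative_inverse_norm_power:
  fixes y z :: "'a::real_inner"
  assumes "z \<noteq> y"
  shows "((\<lambda>z. inverse (norm (z - y)) ^ n) has_derivative
    (\<lambda>h. - (real n * inverse (norm (z - y)) ^ (n + 2) * ((z - y) \<bullet> h)))) (at z)"
proof -
  have "((\<lambda>z. z - y) has_derivative (\<lambda>h. h)) (at z)"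
    by (auto intro!: derivative_eq_intros)
  from has_derivative_compose[OF this has_derivative_norm]
  have "((\<lambda>z. norm (z - y)) has_derivative (\<lambda>h. sgn (z - y) \<bullet> h)) (at z)"
    using assms by (simp add: inner_commute)
  from Deriv.has_derivative_inverse[OF _ this]
  have "((\<lambda>z. inverse (norm (z - y))) has_derivative
      (\<lambda>h. - (inverse (norm (z - y)) ^ 3 * ((z - y) \<bullet> h)))) (at z)"
    using assms by (simp add: sgn_div_norm divide_inverse power3_eq_cube mult_ac)
  \<comment> \<open>The power rule contributes exponent \<open>n - 1\<close>, and (n - 1) + 3 = n +
    2. The case split handles truncated subtraction at \<open>n = 0\<close>.\<close>
  from has_derivative_power[OF this, of n] show ?thesis
    by (cases n) (auto simp: numeral_eq_Suc algebra_simps)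
qed

lemma stokeslet_solution:
  assumes "\<mu> > 0"
  shows "stokes_solution \<mu> (\<lambda>z. stokeslet \<mu> z y *v b)
    (\<lambda>z. inverse (norm (z - y)) ^ 3 * ((z - y) \<bullet> b) / (4 * pi)) (- {y})"
proof -
  define C where "C = 1 / (8 * pi * \<mu>)"
  define q where "q z = inverse (norm (z - y))" for z
  \<comment> \<open>The exponent 1 lets \<open>dq\<close> below differentiate every occurrence of \<open>q\<close>.\<close>
  define U where "U z = C *\<^sub>R (q z ^ 1 *\<^sub>R b + (q z ^ 3 * ((z - y) \<bullet> b)) *\<^sub>R (z - y))" for z
  \<comment> \<open>\<open>DU z e\<close> is the derivative of \<open>U\<close> along
    \<open>e\<close>, and \<open>DDU z e h\<close> that of \<open>DU z e\<close> along
    \<open>h\<close>. Arbitrary directions keep the formulas coordinate-free; axis vectors are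
    inserted only at the end.\<close>
  define DU where "DU z e = C *\<^sub>R (
      - (q z ^ 3 * ((z - y) \<bullet> e)) *\<^sub>R b + (q z ^ 3 * (b \<bullet> e)) *\<^sub>R (z - y)
      + (q z ^ 3 * ((z - y) \<bullet> b)) *\<^sub>R e
      - (3 * q z ^ 5 * ((z - y) \<bullet> b) * ((z - y) \<bullet> e)) *\<^sub>R (z - y))" for z e
  define DDU where "DDU z e h = C *\<^sub>R (
      - (q z ^ 3 * (h \<bullet> e)) *\<^sub>R b + (3 * q z ^ 5 * ((z - y) \<bullet> e) * ((z - y) \<bullet> h)) *\<^sub>R b
      + (q z ^ 3 * (b \<bullet> e)) *\<^sub>R h - (3 * q z ^ 5 * (b \<bullet> e) * ((z - y) \<bullet> h)) *\<^sub>R (z - y)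
      + (q z ^ 3 * (b \<bullet> h)) *\<^sub>R e - (3 * q z ^ 5 * ((z - y) \<bullet> b) * ((z - y) \<bullet> h)) *\<^sub>R e
      - (3 * q z ^ 5 * (b \<bullet> h) * ((z - y) \<bullet> e)) *\<^sub>R (z - y)
      - (3 * q z ^ 5 * ((z - y) \<bullet> b) * (h \<bullet> e)) *\<^sub>R (z - y)
      - (3 * q z ^ 5 * ((z - y) \<bullet> b) * ((z - y) \<bullet> e)) *\<^sub>R h
      + (15 * q z ^ 7 * ((z - y) \<bullet> b) * ((z - y) \<bullet> e) * ((z - y) \<bullet> h)) *\<^sub>R (z - y))" for z e h
  define p where "p z = q z ^ 3 * ((z - y) \<bullet> b) / (4 * pi)" for z
  have dq: "((\<lambda>z. q z ^ n) has_derivative (\<lambda>h. - (real n * q z ^ (n + 2) * ((z - y) \<bullet> h)))) (at z)"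
    if "z \<noteq> y" for z n
    unfolding q_def using that by (rule has_derivative_inverse_norm_power)
  have dU: "(U has_derivative DU z) (at z)" if "z \<noteq> y" for z
    unfolding U_def[abs_def]
    by (rule derivative_eq_intros dq that refl)+
      (auto simp: fun_eq_iff DU_def vec_eq_iff algebra_simps inner_commute numeral_eq_Suc)
  have dDU: "((\<lambda>z. DU z e) has_derivative DDU z e) (at z)" if "z \<noteq> y" for z e
    unfolding DU_def
    by (rule derivative_eq_intros dq that refl)+
      (auto simp: fun_eq_iff DDU_def vec_eq_iff algebra_simps inner_commute numeral_eq_Suc)
  have dp: "(p has_derivative (\<lambda>h. (q z ^ 3 * (b \<bullet> h) - 3 * q z ^ 5 * ((z - y) \<bullet> b) * ((z - y) \<bullet> h)) / (4 * pi))) (at z)"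
    if "z \<noteq> y" for z
    unfolding p_def[abs_def]
    by (rule derivative_eq_intros dq that refl)+
      (auto simp: fun_eq_iff field_simps inner_commute numeral_eq_Suc)
  have pU: "partial_deriv i U z = DU z (axis i 1)" if "z \<in> - {y}" for z i
    using dU that by (auto intro: partial_deriv_eqI)
  have open_y: "open (- {y})" by auto
  have "stokes_solution \<mu> U p (- {y})"
    unfolding stokes_solution_def
  proof (intro ballI conjI allI)
    fix z assume z: "z \<in> - {y}"
    then have zy: "z \<noteq> y" by simp
    have ddiff: "(\<lambda>z. DU z (axis i 1)) differentiable (at z)" for i
      using dDU[OF zy] by (auto simp: differentiable_def)
    show "U differentiable (at z)" "p differentiable (at z)"
      using dU[OF zy] dp[OF zy] by (auto simp: differentiable_def)
    show "partial_deriv i U differentiable (at z)" for i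
      using partial_deriv_cong_open(1)[OF open_y z pU ddiff] .
    have ppU: "partial_deriv i (partial_deriv i U) z = DDU z (axis i 1) (axis i 1)" for i
      using partial_deriv_cong_open(2)[OF open_y z pU ddiff] partial_deriv_eqI[OF dDU[OF zy]]
      by simp
    \<comment> \<open>The only relation between \<open>q z\<close> and \<open>z - y\<close> that the
      equations need; all else is polynomial algebra with \<open>q z\<close> treated as an
      independent symbol.\<close>
    have qn: "q z ^ (k + 2) * (norm (z - y))\<^sup>2 = q z ^ k" for k
      using zy by (simp add: q_def field_simps power2_eq_square)
    define r where "r = z - y"
    have norm2: "r $ 1 * r $ 1 + r $ 2 * r $ 2 + r $ 3 * r $ 3 = (norm (z - y))\<^sup>2"
      by (simp add: r_def power2_norm_eq_inner inner_vec_def sum_3)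
    have q5: "q z ^ 5 * (r $ 1 * r $ 1 + r $ 2 * r $ 2 + r $ 3 * r $ 3) - q z ^ 3 = 0"
      and q7: "q z ^ 7 * (r $ 1 * r $ 1 + r $ 2 * r $ 2 + r $ 3 * r $ 3) - q z ^ 5 = 0"
      unfolding norm2 using qn[of 3] qn[of 5] by simp_all
    define rb where "rb = r \<bullet> b"
    have rb: "rb = r $ 1 * b $ 1 + r $ 2 * b $ 2 + r $ 3 * b $ 3"
      by (simp add: rb_def inner_vec_def sum_3)
    have lap: "laplacian U z = C *\<^sub>R ((2 * q z ^ 3) *\<^sub>R b - (6 * q z ^ 5 * rb) *\<^sub>R r)"
    proof -
      \<comment> \<open>The trace of \<open>DDU\<close> equals the target plus multiples of the two
        expressions that vanish by \<open>q5\<close> and \<open>q7\<close>. With these corrections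
        written out, each component is a pure ring identity.\<close>
      have "laplacian U z $ a = (C *\<^sub>R ((2 * q z ^ 3) *\<^sub>R b - (6 * q z ^ 5 * rb) *\<^sub>R r)) $ a
          + 3 * C * b $ a * (q z ^ 5 * (r $ 1 * r $ 1 + r $ 2 * r $ 2 + r $ 3 * r $ 3) - q z ^ 3)
          + 15 * C * rb * r $ a * (q z ^ 7 * (r $ 1 * r $ 1 + r $ 2 * r $ 2 + r $ 3 * r $ 3) - q z ^ 5)"
        for a
        unfolding laplacian_def ppU DDU_def r_def[symmetric] rb_def[symmetric] sum_3
        using exhaust_3[of a]
        by (elim disjE; simp add: inner_axis inner_axis_axis; simp add: axis_def rb algebra_simps)
      then show ?thesis
        unfolding q5 q7 by (simp add: vec_eq_iff)
    qed
    have "gradient p z $ i = (q z ^ 3 * b $ i - 3 * q z ^ 5 * rb * r $ i) / (4 * pi)" for i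
      using partial_deriv_eqI[OF dp[OF zy]] by (simp add: gradient_def inner_axis rb_def r_def)
    then have grad: "gradient p z = (1 / (4 * pi)) *\<^sub>R (q z ^ 3 *\<^sub>R b - (3 * q z ^ 5 * rb) *\<^sub>R r)"
      by (simp add: vec_eq_iff)
    show "- \<mu> *\<^sub>R laplacian U z + gradient p z = 0"
      \<comment> \<open>Since \<mu> C = 1 / (8 pi), the factors 2 and 6 in \<open>lap\<close> become
        the factors 1 and 3 over 4 pi in \<open>grad\<close>.\<close>
      using assms unfolding lap grad C_def by (simp add: vec_eq_iff field_simps)
    have "divergence U z
        = - 3 * C * rb * (q z ^ 5 * (r $ 1 * r $ 1 + r $ 2 * r $ 2 + r $ 3 * r $ 3) - q z ^ 3)"
      unfolding divergence_def pU[OF z] DU_def r_def[symmetric] rb_def[symmetric] sum_3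
      by (simp add: inner_axis, simp add: axis_def rb algebra_simps)
    then show "divergence U z = 0"
      unfolding q5 by simp
  qed
  moreover have "U = (\<lambda>z. stokeslet \<mu> z y *v b)"
    by (simp add: fun_eq_iff U_def stokeslet_mult_vec q_def C_def)
  ultimately show ?thesis
    unfolding p_def[abs_def] q_def by simp
qed


section \<open>Block matrices\<close>

lemma stack2_eq_iff: "stack2 v w = stack2 v' w' \<longleftrightarrow> v = v' \<and> w = w'"
proof
  assume h: "stack2 v w = stack2 v' w'"
  have "v $ a = v' $ a" "w $ a = w' $ a" for a
    using arg_cong[OF h, of "\<lambda>s. s $ Inl a"] arg_cong[OF h, of "\<lambda>s. s $ Inr a"]
    by (simp_all add: stack2_def)
  then show "v = v' \<and> w = w'" by (simp add: vec_eq_iff)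
qed simp

lemma stack2_surj: "\<exists>v w. s = stack2 v w"
proof (intro exI)
  show "s = stack2 (\<chi> a. s $ Inl a) (\<chi> a. s $ Inr a)"
    by (simp add: stack2_def vec_eq_iff split: sum.split)
qed

lemma sum_UNIV_prod: "(\<Sum>r\<in>UNIV. g r) = (\<Sum>j\<in>UNIV. \<Sum>a\<in>UNIV. g (j, a))"
  for g :: "'n::finite \<times> 'a::finite \<Rightarrow> 'b::comm_monoid_add"
  by (simp add: sum.cartesian_product)

lemma sum_UNIV_sum: "(\<Sum>r\<in>UNIV. g r) = (\<Sum>a\<in>UNIV. g (Inl a)) + (\<Sum>a\<in>UNIV. g (Inr a))"
  for g :: "'n::finite + 'a::finite \<Rightarrow> 'b::comm_monoid_add"
  by (simp add: UNIV_Plus_UNIV[symmetric] sum.Plus del: UNIV_Plus_UNIV)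

lemma block_S_mat_mult:
  "block (S_mat \<mu> x y *v b) i = (\<Sum>j\<in>UNIV. stokeslet \<mu> (x i) (y j) *v block b j)"
  by (simp add: block_def S_mat_def matrix_vector_mult_def vec_eq_iff sum_UNIV_prod)

lemma block_K_mat_mult: "block (K_mat c z *v stack2 v w) j = rigid_motion c v w (z j)"
  by (auto simp: block_def K_mat_def stack2_def matrix_vector_mult_def vec_eq_iff sum_UNIV_sum
      rigid_motion_def cross_mat_def cross3_def mat_def sum_3 forall_3 algebra_simps)

text \<open>\<open>cross_mat d\<close> is antisymmetric, so its transpose sends b to d x b rather
  than b x d. The same matrix that generates rigid motions therefore measures force and torque with
  the right sign.\<close>

lemma transpose_K_mat_mult:
  "transpose (K_mat c z) *v b =
    stack2 (\<Sum>j\<in>UNIV. block b j) (\<Sum>j\<in>UNIV. cross3 (z j - c) (block b j))"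
proof -
  have "(transpose (K_mat c z) *v b) $ q
      = stack2 (\<Sum>j\<in>UNIV. block b j) (\<Sum>j\<in>UNIV. cross3 (z j - c) (block b j)) $ q" for q
  proof (cases q)
    case (Inl a)
    then show ?thesis
      using exhaust_3[of a]
      by (auto simp: transpose_def block_def K_mat_def stack2_def matrix_vector_mult_def
          sum_UNIV_prod mat_def sum_3)
  next
    case (Inr a)
    then show ?thesis
      using exhaust_3[of a]
      by (auto simp: transpose_def block_def K_mat_def stack2_def matrix_vector_mult_def
          sum_UNIV_prod cross_mat_def cross3_def sum_3 algebra_simps intro!: sum.cong)
  qed
  then show ?thesis by (simp add: vec_eq_iff)
qed

lemma transpose_block_diag_mult:
  "transpose (block_diag A) *v stack b = stack (\<lambda>k. transpose (A k) *v b k)"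
proof -
  have "(transpose (block_diag A) *v stack b) $ (k, s) = (transpose (A k) *v b k) $ s" for k s
  proof -
    have "(transpose (block_diag A) *v stack b) $ (k, s)
        = (\<Sum>k'\<in>UNIV. if k' = k then \<Sum>r\<in>UNIV. A k' $ r $ s * b k' $ r else 0)"
      unfolding matrix_vector_mult_def transpose_def block_diag_def stack_def
      by (simp add: sum_UNIV_prod del: sum.delta sum.delta' cong: if_cong) (intro sum.cong refl, auto)
    then show ?thesis
      by (simp add: matrix_vector_mult_def transpose_def)
  qed
  then show ?thesis by (simp add: vec_eq_iff stack_def)
qed

text \<open>The Gram matrix cancels against its inverse inside \<open>L_mat\<close>. Hence densities
  in the range of I - L carry no net force or torque.\<close>

lemma transpose_K_mat_L_mat:
  assumes "invertible (transpose (K_mat c y) ** K_mat c y)"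
  shows "transpose (K_mat c y) ** L_mat c y = transpose (K_mat c y)"
proof -
  let ?G = "transpose (K_mat c y) ** K_mat c y"
  have "transpose (K_mat c y) ** L_mat c y = (?G ** matrix_inv ?G) ** transpose (K_mat c y)"
    unfolding L_mat_def by (simp add: matrix_mul_assoc)
  \<comment> \<open>\<open>matrix_inv\<close> is a choice term; invertibility supplies the witness
    that makes it a true inverse.\<close>
  moreover have "?G ** matrix_inv ?G = mat 1"
    using assms someI_ex[of "\<lambda>A'. ?G ** A' = mat 1 \<and> A' ** ?G = mat 1"]
    unfolding invertible_def matrix_inv_def by blast
  ultimately show ?thesis by simp
qed

lemma block_sum: "block (\<Sum>s\<in>A. g s) i = (\<Sum>s\<in>A. block (g s) i)"
  by (simp add: block_def vec_eq_iff)

section \<open>From the linear system to rigid motions, forces and torques\<close>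

theorem proposition2:
  fixes \<mu> :: real
    and \<Omega> :: "'p::finite \<Rightarrow> (real^3) set"
    and c :: "'p \<Rightarrow> real^3"
    and y :: "'p \<Rightarrow> 'n::finite \<Rightarrow> real^3"
    and x :: "'p \<Rightarrow> 'm::finite \<Rightarrow> real^3"
    and f t \<nu> \<xi> :: "'p \<Rightarrow> real^3"
    and lam lam0 \<beta> :: "'p \<Rightarrow> real^('n \<times> 3)"
    and u0 :: "'p \<Rightarrow> real^('m \<times> 3)"
    and u :: "real^3 \<Rightarrow> real^3"
  assumes viscosity: "\<mu> > 0"
    and particles: "\<And>k. smooth_bounded_domain (\<Omega> k)" "disjoint_family \<Omega>"
    and proxy_points: "\<And>k j. y k j \<in> \<Omega> k"
    and nodes: "\<And>k i. x k i \<in> frontier (\<Omega> k)"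
    and tall: "CARD('n) < CARD('m)"
    and gram_invertible: "\<And>k. invertible (transpose (K_mat (c k) (y k)) ** K_mat (c k) (y k))"
    and \<nu>_\<xi>: "\<And>k. (transpose (K_mat (c k) (y k)) ** K_mat (c k) (y k)) *v stack2 (\<nu> k) (\<xi> k)
                  = stack2 (f k) (t k)"
    and lam0: "\<And>k. lam0 k = K_mat (c k) (y k) *v stack2 (\<nu> k) (\<xi> k)"
    and u0: "\<And>k. u0 k = (\<Sum>k'\<in>UNIV. S_mat \<mu> (x k) (y k') *v lam0 k')"
    and system: "\<And>k. (S_mat \<mu> (x k) (y k) ** (mat 1 - L_mat (c k) (y k))
                        + Lr_mat (c k) (x k) (y k)) *v lam k
                    + (\<Sum>k'\<in>UNIV - {k}.
                        (S_mat \<mu> (x k) (y k') ** (mat 1 - L_mat (c k') (y k'))) *v lam k')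
                    = - u0 k"
    and \<beta>: "\<And>k. \<beta> k = (mat 1 - L_mat (c k) (y k)) *v lam k + lam0 k"
    and u: "\<And>z. u z = (\<Sum>k\<in>UNIV. \<Sum>j\<in>UNIV. stokeslet \<mu> z (y k j) *v block (\<beta> k) j)"
  shows "(\<exists>p. stokes_solution \<mu> u p (UNIV - closure (\<Union>k. \<Omega> k)))
    \<and> (\<exists>v w.
        (\<forall>k. (\<forall>i. u (x k i) = v k + cross3 (w k) (x k i - c k))
           \<and> (nodes_resolve_surface \<mu> y (c k) (x k) (frontier (\<Omega> k)) \<longrightarrow>
                (\<forall>z\<in>frontier (\<Omega> k). u z = v k + cross3 (w k) (z - c k))))
      \<and> stack (\<lambda>k. stack2 (v k) (w k))
          = - (transpose (block_diag (\<lambda>k. K_mat (c k) (y k))) *v stack lam)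
      \<and> (\<forall>k. stack2 (v k) (w k) = - (transpose (K_mat (c k) (y k)) *v lam k)))
    \<and> (\<forall>k. (\<Sum>j\<in>UNIV. block (\<beta> k) j) = f k
         \<and> (\<Sum>j\<in>UNIV. cross3 (y k j - c k) (block (\<beta> k) j)) = t k)"
proof -
  let ?K = "\<lambda>k. K_mat (c k) (y k)"
  have stokes: "stokes_solution \<mu> u
      (\<lambda>z. \<Sum>k\<in>UNIV. \<Sum>j\<in>UNIV. inverse (norm (z - y k j)) ^ 3 * ((z - y k j) \<bullet> block (\<beta> k) j) / (4 * pi))
      (UNIV - closure (\<Union>k. \<Omega> k))"
  proof -
    have "UNIV - closure (\<Union>k. \<Omega> k) \<subseteq> - {y k j}" for k j
      using proxy_points[of k j] closure_subset[of "\<Union>k. \<Omega> k"] by auto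
    moreover have "open (UNIV - closure (\<Union>k. \<Omega> k))"
      by (simp add: open_Diff)
    ultimately show ?thesis
      unfolding u[abs_def] using viscosity
      by (intro stokes_solution_sum stokes_solution_subset[OF stokeslet_solution])
  qed
  \<comment> \<open>The motions are defined by splitting the vector of the extraction formula, so
    that formula holds by construction and rigidity is what remains to be shown.\<close>
  have "\<exists>v w. - (transpose (?K k) *v lam k) = stack2 v w" for k
    by (rule stack2_surj)
  then obtain v w where vw: "\<And>k. stack2 (v k) (w k) = - (transpose (?K k) *v lam k)"
    by metis
  have node: "u (x k i) = rigid_motion (c k) (v k) (w k) (x k i)" for k i
  proof -
    have "(\<Sum>k'\<in>UNIV. S_mat \<mu> (x k) (y k') *v \<beta> k')
        = (\<Sum>k'\<in>UNIV. (S_mat \<mu> (x k) (y k') ** (mat 1 - L_mat (c k') (y k'))) *v lam k') + u0 k"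
      by (simp add: \<beta> u0 matrix_vector_right_distrib matrix_vector_mul_assoc sum.distrib)
    \<comment> \<open>Splitting off the term k' = k of the full sum matches it with the block row of
      \<open>system\<close>; \<open>u0 k\<close> cancels and only the recompletion term is
      left.\<close>
    also have "\<dots> = - (Lr_mat (c k) (x k) (y k) *v lam k)"
      using system[of k] by (simp add: sum.remove[of UNIV k] matrix_vector_mult_add_rdistrib
          algebra_simps eq_neg_iff_add_eq_0)
    also have "\<dots> = K_mat (c k) (x k) *v stack2 (v k) (w k)"
      by (simp add: vw Lr_mat_def matrix_vector_mul_assoc[symmetric] linear_neg[OF matrix_vector_mul_linear])
    finally have "block (\<Sum>k'\<in>UNIV. S_mat \<mu> (x k) (y k') *v \<beta> k') i
        = block (K_mat (c k) (x k) *v stack2 (v k) (w k)) i"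
      by simp
    then show ?thesis
      by (simp add: block_sum block_S_mat_mult block_K_mat_mult u)
  qed
  have u_flow: "u = flow \<mu> y \<beta>"
    by (simp add: fun_eq_iff u flow_def)
  \<comment> \<open>The resolution condition quantifies over all densities and motions, so it
    applies to \<open>\<beta>\<close> with \<open>v k\<close> and \<open>w k\<close>, extending the
    identity from the nodes to the surface.\<close>
  have surface: "\<forall>z\<in>frontier (\<Omega> k). u z = rigid_motion (c k) (v k) (w k) z"
    if "nodes_resolve_surface \<mu> y (c k) (x k) (frontier (\<Omega> k))" for k
    using that[unfolded nodes_resolve_surface_def, rule_format, of \<beta> "v k" "w k"] node[of k]
    by (simp add: u_flow)
  have stacked: "stack (\<lambda>k. stack2 (v k) (w k)) = - (transpose (block_diag ?K) *v stack lam)"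
    unfolding transpose_block_diag_mult vw by (simp add: stack_def vec_eq_iff)
  have force: "(\<Sum>j\<in>UNIV. block (\<beta> k) j) = f k
         \<and> (\<Sum>j\<in>UNIV. cross3 (y k j - c k) (block (\<beta> k) j)) = t k" for k
  proof -
    have "transpose (?K k) *v ((mat 1 - L_mat (c k) (y k)) *v lam k) = 0"
      by (simp add: matrix_vector_mult_diff_rdistrib matrix_vector_mult_diff_distrib
          matrix_vector_mul_assoc transpose_K_mat_L_mat[OF gram_invertible[of k]]
          del: transpose_matrix_vector)
    \<comment> \<open>What survives is the Gram matrix applied to the coefficients of
      \<open>lam0 k\<close>, which \<open>\<nu>_\<xi>\<close> prescribes.\<close>
    then have "transpose (?K k) *v \<beta> k = stack2 (f k) (t k)"
      using \<nu>_\<xi>[of k]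
      unfolding \<beta> lam0 by (simp add: matrix_vector_right_distrib matrix_vector_mul_assoc
          del: transpose_matrix_vector)
    then show ?thesis
      unfolding transpose_K_mat_mult stack2_eq_iff .
  qed
  show ?thesis
  proof (intro conjI allI exI impI)
    show "stokes_solution \<mu> u
      (\<lambda>z. \<Sum>k\<in>UNIV. \<Sum>j\<in>UNIV. inverse (norm (z - y k j)) ^ 3 * ((z - y k j) \<bullet> block (\<beta> k) j) / (4 * pi))
      (UNIV - closure (\<Union>k. \<Omega> k))"
      by (rule stokes)
    show "u (x k i) = v k + cross3 (w k) (x k i - c k)" for k i
      using node by (simp add: rigid_motion_def)
    show "\<forall>z\<in>frontier (\<Omega> k). u z = v k + cross3 (w k) (z - c k)"
      if "nodes_resolve_surface \<mu> y (c k) (x k) (frontier (\<Omega> k))" for k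
      using surface[OF that] by (simp add: rigid_motion_def)
  qed (use stacked vw force in auto)
qed

end
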